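(* Suppose every arc function $\varphi_a$, $a\in\mathcal{A}$, is admissible, i.e. satisfies (A1)–(A4) of the context. Let $X>0$, let $s,d\in\mathcal{T}$, and let $\mathcal{P}_k$ be the candidate set of $k$ token paths from $s$ to $d$ described in the context. Let $\delta^*=(\delta^*_p)_{p\in\mathcal{P}_k}$ be an optimal solution of $$\max_{\delta\ge0}\ \sum_{p\in\mathcal{P}_k}y_p(\delta_p)\quad\text{s.t.}\quad\sum_{p\in\mathcal{P}_k}\delta_p=X,$$ with KKT multiplier $\lambda^*$, i.e. $\lambda^*\in\mathbb{R}$ satisfies $y_p'(\delta_p^* )=\lambda^*$ for every $p\in\mathcal{P}_k$ with $\delta_p^*>0$, and $y_p'(0^+)\le\lambda^*$ for every $p\in\mathcal{P}_k$ with $\delta_p^*=0$. If $$\max_{q:\ s\to d,\ q\text{ pool-simple}} y_q'(0^+)\le\lambda^*,$$ where the maximum is over all pool-simple token paths $q$ from $s$ to $d$, then $\delta^*$ (extended by $\delta_q^*=0$ for pool-simple paths $q\notin\mathcal{P}_k$) is globally optimal over all pool-simple paths within the path-separable model: writing $\mathcal{Q}$ for the set of all pool-simple token paths from $s$ to $d$, it maximizes $\sum_{q\in\mathcal{Q}}y_q(\delta_q)$ over all $\delta\in\mathbb{R}_{\ge0}^{\mathcal{Q}}$ with $\sum_{q\in\mathcal{Q}}\delta_q=X$.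
   Context: Let $\mathcal{T}$ be a finite set of tokens and $\mathcal{V}$ a finite set of venues; each venue $v$ supports a set $\mathcal{E}_v\subseteq\mathcal{T}\times\mathcal{T}$ of directed tradable pairs. The token multigraph is $G_T=(\mathcal{T},\mathcal{A})$, with one directed arc $a=(i\to j;v)\in\mathcal{A}$ for each $v\in\mathcal{V}$ and each $(i,j)\in\mathcal{E}_v$ (parallel arcs are allowed). Each arc $a$ has an associated liquidity pool $\mathrm{pool}(a)$ and carries an exchange function $\varphi_a:\mathbb{R}_{\ge0}\to\mathbb{R}_{\ge0}$. Admissibility of $\varphi_a$ means: (A1) $\varphi_a(0)=0$; (A2) $\varphi_a$ is continuous and nondecreasing; (A3) $\varphi_a$ is concave on $\mathbb{R}_{\ge0}$; (A4) $\varphi_a$ is differentiable on $(0,\infty)$, with finite right derivative $\varphi_a'(0^+)$ at $0$. A token path from $s$ to $d$ is a sequence of arcs $p=(a_1,\dots,a_L)$, $a_\ell=(t_{\ell-1}\to t_\ell;v_\ell)$, with $t_0=s$ and $t_L=d$. It is pool-simple if $\mathrm{pool}(a_\ell)\ne\mathrm{pool}(a_m)$ for all $\ell\ne m$. Its path exchange function is $y_p=\varphi_{a_L}\circ\cdots\circ\varphi_{a_1}$, and $y_p'(0^+)$ is the right derivative of $y_p$ at $0$. Path-separable model: each path's output is a function of the flow assigned to that path alone, so an allocation $\delta=(\delta_p)$ over a set of paths has total output $\sum_p y_p(\delta_p)$, even if different paths share pools. Candidate set: each arc $a$ has a marginal exchange proxy $\pi_a=\varphi_a'(\bar x_a)$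 at a reference input $\bar x_a$, a gas cost $g_a\ge0$, and a score $w_a=-\log\pi_a+\gamma g_a$ with a parameter $\gamma>0$; the score of a path is $\ell(p)=\sum_{a\in p}w_a$. $\mathcal{P}_k$ is the set of the $k$ loopless (no repeated token) pool-simple token paths from $s$ to $d$ with smallest $\ell(p)$. *)

theory Defs
  imports "HOL-Analysis.Analysis" "HOL-Library.Extended_Real"
begin

section \<open>Functions on the nonnegative reals\<close>

(* A function on [0,\<infinity>) is represented by a function on all reals whose values at negative
   arguments are irrelevant. The derivative relative to {0..} is the right derivative at 0 and
   the ordinary two-sided derivative at every positive point. *)
definition nonneg_deriv :: "(real \<Rightarrow> real) \<Rightarrow> real \<Rightarrow> real" where
  "nonneg_deriv f x = vector_derivative f (at x within {0..})"

(* The first conjunct says that the codomain is [0,\<infinity>); the others are (A1)-(A4) in order. *)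
definition admissible :: "(real \<Rightarrow> real) \<Rightarrow> bool" where
  "admissible f \<longleftrightarrow>
     (\<forall>x\<ge>0. f x \<ge> 0) \<and>
     f 0 = 0 \<and>
     (continuous_on {0..} f \<and> mono_on {0..} f) \<and>
     concave_on {0..} f \<and>
     ((\<forall>x>0. f differentiable (at x)) \<and>
      (\<exists>D. (f has_real_derivative D) (at_right 0)))"

section \<open>The token multigraph\<close>

(* (i, j, v) is the arc i \<rightarrow> j offered by venue v. *)
type_synonym ('t, 'v) arc = "'t \<times> 't \<times> 'v"

definition src :: "('t, 'v) arc \<Rightarrow> 't" where
  "src a = fst a"

definition tgt :: "('t, 'v) arc \<Rightarrow> 't" where
  "tgt a = fst (snd a)"

definition arcs :: "'v set \<Rightarrow> ('v \<Rightarrow> ('t \<times> 't) set) \<Rightarrow> ('t, 'v) arc set" where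
  "arcs V E = {(i, j, v) | i j v. v \<in> V \<and> (i, j) \<in> E v}"

(* A path has at least one arc. *)
definition token_path :: "('t, 'v) arc set \<Rightarrow> 't \<Rightarrow> 't \<Rightarrow> ('t, 'v) arc list \<Rightarrow> bool" where
  "token_path A s d p \<longleftrightarrow>
     p \<noteq> [] \<and> set p \<subseteq> A \<and> src (hd p) = s \<and> tgt (last p) = d \<and>
     (\<forall>l. Suc l < length p \<longrightarrow> tgt (p ! l) = src (p ! Suc l))"

definition pool_simple :: "(('t, 'v) arc \<Rightarrow> 'p) \<Rightarrow> ('t, 'v) arc list \<Rightarrow> bool" where
  "pool_simple pool p \<longleftrightarrow> distinct (map pool p)"

definition loopless :: "('t, 'v) arc list \<Rightarrow> bool" where
  "loopless p \<longleftrightarrow> distinct (src (hd p) # map tgt p)"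

definition pool_simple_paths ::
  "('t, 'v) arc set \<Rightarrow> (('t, 'v) arc \<Rightarrow> 'p) \<Rightarrow> 't \<Rightarrow> 't \<Rightarrow> ('t, 'v) arc list set" where
  "pool_simple_paths A pool s d = {p. token_path A s d p \<and> pool_simple pool p}"

(* fold \<phi> [a1, ..., aL] = \<phi> aL \<circ> ... \<circ> \<phi> a1, i.e. the first arc is applied first. *)
definition path_fun :: "(('t, 'v) arc \<Rightarrow> real \<Rightarrow> real) \<Rightarrow> ('t, 'v) arc list \<Rightarrow> real \<Rightarrow> real" where
  "path_fun \<phi> p = fold \<phi> p"

lemma finite_arcs:
  assumes "finite T" "finite V" "\<And>v. v \<in> V \<Longrightarrow> E v \<subseteq> T \<times> T"
  shows "finite (arcs V E)"
proof (rule finite_subset)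
  show "arcs V E \<subseteq> T \<times> T \<times> V"
    using assms(3) unfolding arcs_def by blast
qed (use assms in auto)

(* The set over which a maximum is taken in the optimality criterion is finite. *)
lemma finite_pool_simple_paths:
  assumes "finite A"
  shows "finite (pool_simple_paths A pool s d)"
proof (rule finite_subset)
  show "pool_simple_paths A pool s d \<subseteq> {p. set p \<subseteq> A \<and> distinct p}"
    by (auto simp: pool_simple_paths_def token_path_def pool_simple_def distinct_map)
  show "finite {p. set p \<subseteq> A \<and> distinct p}"
    using finite_subset_distinct[OF assms] .
qed

section \<open>Candidate paths\<close>

(* The proxy \<pi> is nonnegative for a nondecreasing exchange function. The score is
   extended-real-valued so that \<pi> = 0 gives -log 0 = \<infinity> (whereas ln 0 = 0 in HOL). *)
definition arc_score ::
  "(('t, 'v) arc \<Rightarrow> real \<Rightarrow> real) \<Rightarrow> (('t, 'v) arc \<Rightarrow> real) \<Rightarrow> (('t, 'v) arc \<Rightarrow> real) \<Rightarrow> real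
    \<Rightarrow> ('t, 'v) arc \<Rightarrow> ereal" where
  "arc_score \<phi> xbar g \<gamma> a =
     (let \<pi> = nonneg_deriv (\<phi> a) (xbar a)
      in if \<pi> > 0 then ereal (- ln \<pi> + \<gamma> * g a) else \<infinity>)"

definition path_score :: "(('t, 'v) arc \<Rightarrow> ereal) \<Rightarrow> ('t, 'v) arc list \<Rightarrow> ereal" where
  "path_score w p = (\<Sum>a\<leftarrow>p. w a)"

(* P consists of k paths of smallest score among the loopless pool-simple ones, ties being
   broken arbitrarily; if fewer than k such paths exist, P consists of all of them. *)
definition candidate_set ::
  "('t, 'v) arc set \<Rightarrow> (('t, 'v) arc \<Rightarrow> 'p) \<Rightarrow> (('t, 'v) arc \<Rightarrow> ereal) \<Rightarrow> 't \<Rightarrow> 't \<Rightarrow> nat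
    \<Rightarrow> ('t, 'v) arc list set \<Rightarrow> bool" where
  "candidate_set A pool w s d k P \<longleftrightarrow>
     (let L = {p \<in> pool_simple_paths A pool s d. loopless p}
      in P \<subseteq> L \<and> card P = min k (card L) \<and>
         (\<forall>p\<in>P. \<forall>q\<in>L - P. path_score w p \<le> path_score w q))"

section \<open>Flow allocation in the path-separable model\<close>

(* Allocations are total functions; only their values on the path set P matter. *)
definition feasible :: "'q set \<Rightarrow> real \<Rightarrow> ('q \<Rightarrow> real) \<Rightarrow> bool" where
  "feasible P X \<delta> \<longleftrightarrow> (\<forall>p\<in>P. \<delta> p \<ge> 0) \<and> (\<Sum>p\<in>P. \<delta> p) = X"

definition optimal_allocation ::
  "('q \<Rightarrow> real \<Rightarrow> real) \<Rightarrow> 'q set \<Rightarrow> real \<Rightarrow> ('q \<Rightarrow> real) \<Rightarrow> bool" where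
  "optimal_allocation y P X \<delta> \<longleftrightarrow> is_arg_max (\<lambda>\<delta>. \<Sum>p\<in>P. y p (\<delta> p)) (feasible P X) \<delta>"

definition kkt_multiplier ::
  "('q \<Rightarrow> real \<Rightarrow> real) \<Rightarrow> 'q set \<Rightarrow> ('q \<Rightarrow> real) \<Rightarrow> real \<Rightarrow> bool" where
  "kkt_multiplier y P \<delta> \<mu> \<longleftrightarrow>
     (\<forall>p\<in>P. (\<delta> p > 0 \<longrightarrow> nonneg_deriv (y p) (\<delta> p) = \<mu>) \<and>
            (\<delta> p = 0 \<longrightarrow> nonneg_deriv (y p) 0 \<le> \<mu>))"

end

theory Submission
  imports Defs
begin

text \<open>Each path function is concave and differentiable relative to [0, \<infinity>), so it lies below its
  tangents. At \<open>\<delta>\<close> the tangent of every pool-simple path has slope at most \<open>\<mu>\<close>, with equality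
  wherever \<open>\<delta>\<close> is positive. Hence \<open>y\<^sub>q (\<epsilon>\<^sub>q) \<le> y\<^sub>q (\<delta>\<^sub>q) + \<mu> (\<epsilon>\<^sub>q - \<delta>\<^sub>q)\<close> for any allocation \<open>\<epsilon>\<close>, and
  the \<open>\<mu>\<close>-terms cancel on summation because both allocations have total X.\<close>

text \<open>Along the segment from \<open>c\<close> to \<open>x\<close>, concavity makes every
  difference quotient of \<open>f\<close> at \<open>c\<close> at least \<open>f x - f c\<close>, and
  the limit \<open>D * (x - c)\<close> inherits this bound. The derivative is relative to
  \<open>S\<close>, so \<open>c\<close> may be an endpoint, as at a path with zero flow.\<close>

lemma concave_on_imp_below_tangent:
  fixes f :: "real \<Rightarrow> real"
  assumes conc: "concave_on S f" and c: "c \<in> S" and x: "x \<in> S"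
    and deriv: "(f has_real_derivative D) (at c within S)"
  shows "f x \<le> f c + D * (x - c)"
proof -
  define h where "h = (\<lambda>t. c + t * (x - c))"
  have h_eq: "h t = (1 - t) *\<^sub>R c + t *\<^sub>R x" for t
    by (simp add: h_def algebra_simps)
  have "h ` {0..1} \<subseteq> S"
    using convexD_alt[OF concave_on_imp_convex[OF conc] c x] by (auto simp: h_eq)
  then have "(f has_real_derivative D) (at (h 0) within h ` {0..1})"
    using deriv by (auto simp: h_def intro: DERIV_subset)
  moreover have "(h has_real_derivative (x - c)) (at 0 within {0..1})"
    unfolding h_def by (auto intro!: derivative_eq_intros)
  ultimately have "(f \<circ> h has_real_derivative D * (x - c)) (at 0 within {0..1})"
    by (rule DERIV_image_chain)
  then have lim: "((\<lambda>t. (f (h t) - f c) / t) \<longlongrightarrow> D * (x - c)) (at 0 within {0..1})"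
    by (simp add: has_field_derivative_iff h_def)
  have "f x - f c \<le> (f (h t) - f c) / t" if t: "t \<in> {0..1}" "t \<noteq> 0" for t
  proof -
    have "(1 - t) * f c + t * f x \<le> f (h t)"
      unfolding h_eq using concave_onD[OF conc] c x t by simp
    then show ?thesis
      using t by (simp add: field_simps)
  qed
  then have "\<forall>\<^sub>F t in at 0 within {0..1}. f x - f c \<le> (f (h t) - f c) / t"
    by (simp add: eventually_at_filter)
  \<comment> \<open>A bound passes to the limit only along a nontrivial filter; here 0 is a limit
    point of the unit interval.\<close>
  moreover have "at (0::real) within {0..1} \<noteq> bot"
    by (simp add: at_within_Icc_at_right)
  ultimately have "f x - f c \<le> D * (x - c)"
    using lim by (intro tendsto_lowerbound)
  then show ?thesis by simp
qed

text \<open>\<open>nonneg_deriv\<close> picks its value by choice, so it is a genuine derivative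
  only where one exists.\<close>

lemma has_real_derivative_nonneg_deriv:
  assumes "f differentiable (at x within {0..})"
  shows "(f has_real_derivative nonneg_deriv f x) (at x within {0..})"
  using assms
  by (simp add: nonneg_deriv_def has_real_derivative_iff_has_vector_derivative
      flip: vector_derivative_works)

text \<open>Concavity of \<open>g\<close> bounds the combination of outer values; monotonicity of
  \<open>g\<close> then carries the concavity inequality of \<open>f\<close> through.\<close>

lemma concave_on_compose:
  fixes f g :: "real \<Rightarrow> real"
  assumes f: "concave_on S f" and g: "concave_on U g" "mono_on U g" and "f ` S \<subseteq> U"
  shows "concave_on S (g \<circ> f)"
  unfolding concave_on_iff
proof (intro conjI ballI allI impI)
  show "convex S"
    using f by (rule concave_on_imp_convex)
  fix x y u v :: real
  assume *: "x \<in> S" "y \<in> S" "0 \<le> u" "0 \<le> v" "u + v = 1"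
  have U: "f x \<in> U" "f y \<in> U" "f (u *\<^sub>R x + v *\<^sub>R y) \<in> U"
    using assms(4) * convexD[OF \<open>convex S\<close>] by auto
  have "u * g (f x) + v * g (f y) \<le> g (u *\<^sub>R f x + v *\<^sub>R f y)"
    using g(1) U * unfolding concave_on_iff by blast
  \<comment> \<open>\<open>g\<close> is monotone only on \<open>U\<close>, so the convex combination
    of the inner values must lie in \<open>U\<close>, which is convex.\<close>
  also have "\<dots> \<le> g (f (u *\<^sub>R x + v *\<^sub>R y))"
  proof (rule mono_onD[OF g(2)])
    show "u *\<^sub>R f x + v *\<^sub>R f y \<in> U"
      using convexD[OF concave_on_imp_convex[OF g(1)]] U * by blast
    show "u *\<^sub>R f x + v *\<^sub>R f y \<le> f (u *\<^sub>R x + v *\<^sub>R y)"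
      using f * unfolding concave_on_iff by simp
  qed (use U in auto)
  finally show "u * (g \<circ> f) x + v * (g \<circ> f) y \<le> (g \<circ> f) (u *\<^sub>R x + v *\<^sub>R y)"
    by simp
qed

lemma admissible_imp_differentiable_on:
  assumes "admissible f"
  shows "f differentiable_on {0..}"
  unfolding differentiable_on_def
proof
  fix x :: real
  assume "x \<in> {0..}"
  then consider "x > 0" | "x = 0" by fastforce
  then show "f differentiable (at x within {0..})"
  proof cases
    case 1
    then show ?thesis
      using assms by (auto simp: admissible_def intro: differentiable_at_withinI)
  next
    case 2
    then show ?thesis
      using assms real_differentiable_def
      by (auto simp: admissible_def at_within_Ici_at_right)
  qed
qed

text \<open>The three claims are proved in one induction: nonnegative values keep the intermediate
  amounts in the domain where the next arc function is concave, monotone and differentiable.\<close>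

lemma path_fun_properties:
  assumes "\<And>a. a \<in> set p \<Longrightarrow> admissible (\<phi> a)"
  shows "path_fun \<phi> p ` {0..} \<subseteq> {0..}" and "concave_on {0..} (path_fun \<phi> p)"
    and "path_fun \<phi> p differentiable_on {0..}"
proof -
  have "path_fun \<phi> p ` {0..} \<subseteq> {0..} \<and> concave_on {0..} (path_fun \<phi> p)
      \<and> path_fun \<phi> p differentiable_on {0..}"
    using assms
  \<comment> \<open>The last arc acts outermost under \<open>fold\<close>, so appending an arc makes
    the outer function a single arc function, whose monotonicity is part of admissibility.\<close>
  proof (induction p rule: rev_induct)
    case Nil
    then show ?case
      by (simp add: path_fun_def id_def concave_on_ident)
  next
    case (snoc a p)
    let ?f = "path_fun \<phi> p"
    have a: "admissible (\<phi> a)"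
      using snoc.prems by simp
    have f: "?f ` {0..} \<subseteq> {0..}" "concave_on {0..} ?f" "?f differentiable_on {0..}"
      using snoc by auto
    have eq: "path_fun \<phi> (p @ [a]) = \<phi> a \<circ> ?f"
      by (simp add: path_fun_def)
    have "(\<phi> a \<circ> ?f) ` {0..} \<subseteq> {0..}"
      using a f(1) by (auto simp: admissible_def image_subset_iff)
    moreover have "concave_on {0..} (\<phi> a \<circ> ?f)"
      using a f by (intro concave_on_compose) (auto simp: admissible_def)
    moreover have "\<phi> a \<circ> ?f differentiable_on {0..}"
      using f admissible_imp_differentiable_on[OF a] unfolding o_def
      by (auto intro: differentiable_on_compose differentiable_on_subset)
    ultimately show ?case
      unfolding eq by blast
  qed
  then show "path_fun \<phi> p ` {0..} \<subseteq> {0..}" "concave_on {0..} (path_fun \<phi> p)"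
    "path_fun \<phi> p differentiable_on {0..}" by auto
qed

text \<open>Sufficiency of the KKT conditions for a concave objective. It is stated for an arbitrary
  index set so that it can be applied to all pool-simple paths at once.\<close>

lemma optimal_allocation_if_kkt:
  assumes conc: "\<And>q. q \<in> Q \<Longrightarrow> concave_on {0..} (y q)"
    and diff: "\<And>q. q \<in> Q \<Longrightarrow> y q differentiable_on {0..}"
    and feas: "feasible Q X \<delta>"
    and kkt: "kkt_multiplier y Q \<delta> \<mu>"
  shows "optimal_allocation y Q X \<delta>"
  unfolding optimal_allocation_def is_arg_max_linorder
proof (intro conjI allI impI feas)
  fix \<epsilon>
  assume \<epsilon>: "feasible Q X \<epsilon>"
  have "y q (\<epsilon> q) \<le> y q (\<delta> q) + \<mu> * (\<epsilon> q - \<delta> q)" if q: "q \<in> Q" for q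
  proof -
    have nonneg: "\<epsilon> q \<ge> 0" "\<delta> q \<ge> 0"
      using feas \<epsilon> q by (auto simp: feasible_def)
    have "y q (\<epsilon> q) \<le> y q (\<delta> q) + nonneg_deriv (y q) (\<delta> q) * (\<epsilon> q - \<delta> q)"
      using conc[OF q] diff[OF q] nonneg
      by (intro concave_on_imp_below_tangent[of "{0..}"] has_real_derivative_nonneg_deriv)
         (auto simp: differentiable_on_def)
    also have "nonneg_deriv (y q) (\<delta> q) * (\<epsilon> q - \<delta> q) \<le> \<mu> * (\<epsilon> q - \<delta> q)"
    \<comment> \<open>At zero flow the slope is only bounded by \<open>\<mu>\<close>, but the
      increment is nonnegative. At positive flow the increment may have either sign, but the slope
      equals \<open>\<mu>\<close>.\<close>
    proof (cases "\<delta> q = 0")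
      case True
      then show ?thesis
        using kkt q nonneg by (auto simp: kkt_multiplier_def intro!: mult_right_mono)
    next
      case False
      then show ?thesis
        using kkt q nonneg by (auto simp: kkt_multiplier_def)
    qed
    finally show ?thesis by simp
  qed
  then have "(\<Sum>q\<in>Q. y q (\<epsilon> q)) \<le> (\<Sum>q\<in>Q. y q (\<delta> q) + \<mu> * (\<epsilon> q - \<delta> q))"
    by (rule sum_mono)
  also have "\<dots> = (\<Sum>q\<in>Q. y q (\<delta> q)) + \<mu> * ((\<Sum>q\<in>Q. \<epsilon> q) - (\<Sum>q\<in>Q. \<delta> q))"
    by (simp add: sum.distrib sum_subtractf flip: sum_distrib_left)
  also have "\<dots> = (\<Sum>q\<in>Q. y q (\<delta> q))"
    using feas \<epsilon> by (simp add: feasible_def)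
  finally show "(\<Sum>q\<in>Q. y q (\<epsilon> q)) \<le> (\<Sum>q\<in>Q. y q (\<delta> q))" .
qed

theorem theorem3:
  fixes T :: "'t set" and V :: "'v set" and E :: "'v \<Rightarrow> ('t \<times> 't) set"
    and pool :: "('t, 'v) arc \<Rightarrow> 'p"
    and \<phi> :: "('t, 'v) arc \<Rightarrow> real \<Rightarrow> real"
    and xbar g :: "('t, 'v) arc \<Rightarrow> real" and \<gamma> X \<mu> :: real
    and s d :: 't and k :: nat
    and P :: "('t, 'v) arc list set" and \<delta> :: "('t, 'v) arc list \<Rightarrow> real"
  defines "A \<equiv> arcs V E"
  defines "Q \<equiv> pool_simple_paths A pool s d"
  assumes "finite T" and "finite V" and "\<And>v. v \<in> V \<Longrightarrow> E v \<subseteq> T \<times> T"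
    and "\<And>a. a \<in> A \<Longrightarrow> admissible (\<phi> a)"
    and "\<And>a. a \<in> A \<Longrightarrow> xbar a \<ge> 0" and "\<And>a. a \<in> A \<Longrightarrow> g a \<ge> 0" and "\<gamma> > 0"
    and "X > 0" and "s \<in> T" and "d \<in> T"
    and "candidate_set A pool (arc_score \<phi> xbar g \<gamma>) s d k P"
    and "optimal_allocation (path_fun \<phi>) P X \<delta>"
    and "kkt_multiplier (path_fun \<phi>) P \<delta> \<mu>"
    and "(MAX q\<in>Q. nonneg_deriv (path_fun \<phi> q) 0) \<le> \<mu>"
  shows "optimal_allocation (path_fun \<phi>) Q X (\<lambda>q. if q \<in> P then \<delta> q else 0)"
proof (rule optimal_allocation_if_kkt)
  \<comment> \<open>Finiteness lets the sum over \<open>Q\<close> be split along \<open>P\<close>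
    and makes \<open>MAX\<close> a true maximum.\<close>
  have fin: "finite Q"
    unfolding Q_def A_def using assms(3-5) by (intro finite_pool_simple_paths finite_arcs)
  have P: "P \<subseteq> Q"
    using assms(13) by (auto simp: candidate_set_def Let_def Q_def)
  have adm: "admissible (\<phi> a)" if "q \<in> Q" "a \<in> set q" for q a
    using that assms(6) unfolding Q_def pool_simple_paths_def token_path_def by blast
  show "concave_on {0..} (path_fun \<phi> q)" if "q \<in> Q" for q
    using adm[OF that] by (rule path_fun_properties)
  show "path_fun \<phi> q differentiable_on {0..}" if "q \<in> Q" for q
    using adm[OF that] by (rule path_fun_properties)
  have "feasible P X \<delta>"
    using assms(14) by (simp add: optimal_allocation_def is_arg_max_def)
  then show "feasible Q X (\<lambda>q. if q \<in> P then \<delta> q else 0)"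
    using fin P by (simp add: feasible_def sum.If_cases Int_absorb1)
  have "nonneg_deriv (path_fun \<phi> q) 0 \<le> \<mu>" if "q \<in> Q" for q
    using assms(16) fin that by (subst (asm) Max_le_iff) auto
  \<comment> \<open>Positive flow occurs only inside \<open>P\<close>, where the given multiplier
    condition applies; the added paths carry zero flow and are covered by the slope bound just
    obtained.\<close>
  then show "kkt_multiplier (path_fun \<phi>) Q (\<lambda>q. if q \<in> P then \<delta> q else 0) \<mu>"
    using assms(15) by (auto simp: kkt_multiplier_def)
qed

end
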